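(* Let $p$ be a prime, $n$ a positive integer, and let $G$ be the cyclic group $C_{p^n}$ with the presentation $$G=\langle x_1,x_2,\dots,x_n\mid x_1^p=1,\ x_2^p=x_1,\ \dots,\ x_n^p=x_{n-1}\rangle .$$ Let $e_0=e_{x_1}e_{x_2}\cdots e_{x_n}$ and, for $i\in\{1,2,\dots,n\}$, let $e_i=e_{x_1}e_{x_2}\cdots e_{x_{i-1}}e'_{x_i}$. Then the set $\{e_0,e_1,\dots,e_n\}$ is the complete set of primitive central idempotents of the rational group algebra $\mathbb{Q}[G]$.
   Context: For $x\in G$, $e_x=\frac{1+x+x^2+\cdots+x^{p-1}}{p}\in\mathbb{Q}[G]$ and $e'_x=1-e_x$. Empty products are $1$, so $e_1=e'_{x_1}$. *)

theory Defs
  imports "HOL-Computational_Algebra.Primes" "HOL-Algebra.Algebra"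
begin

section \<open>Groups given by generators and relations\<close>

datatype 'i letter = Gen 'i | Inv 'i

type_synonym 'i word = "'i letter list"

fun letter_value :: "('a, 'm) monoid_scheme \<Rightarrow> ('i \<Rightarrow> 'a) \<Rightarrow> 'i letter \<Rightarrow> 'a" where
  "letter_value G x (Gen i) = x i"
| "letter_value G x (Inv i) = inv\<^bsub>G\<^esub> (x i)"

fun word_value :: "('a, 'm) monoid_scheme \<Rightarrow> ('i \<Rightarrow> 'a) \<Rightarrow> 'i word \<Rightarrow> 'a" where
  "word_value G x [] = \<one>\<^bsub>G\<^esub>"
| "word_value G x (l # w) = letter_value G x l \<otimes>\<^bsub>G\<^esub> word_value G x w"

text \<open>
  Two words over the generators indexed by \<open>I\<close> represent the same element of the abstract
  group \<open>\<langle>I | R\<rangle>\<close>. A pair \<open>(l, r) \<in> R\<close> stands for the defining relation \<open>l = r\<close>.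
\<close>

inductive word_equiv :: "'i set \<Rightarrow> ('i word \<times> 'i word) set \<Rightarrow> 'i word \<Rightarrow> 'i word \<Rightarrow> bool"
  for I R where
  refl: "word_equiv I R w w"
| sym: "word_equiv I R v w \<Longrightarrow> word_equiv I R w v"
| trans: "word_equiv I R u v \<Longrightarrow> word_equiv I R v w \<Longrightarrow> word_equiv I R u w"
| cancel_right: "i \<in> I \<Longrightarrow> word_equiv I R (u @ [Gen i, Inv i] @ v) (u @ v)"
| cancel_left: "i \<in> I \<Longrightarrow> word_equiv I R (u @ [Inv i, Gen i] @ v) (u @ v)"
| relation: "(l, r) \<in> R \<Longrightarrow> word_equiv I R (u @ l @ v) (u @ r @ v)"

definition words_over :: "'i set \<Rightarrow> 'i word set" where
  "words_over I = lists (Gen ` I \<union> Inv ` I)"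

text \<open>
  \<open>G = \<langle>x i (i \<in> I) | R\<rangle>\<close>: the \<open>x i\<close> generate \<open>G\<close>, and the equations between words in the
  \<open>x i\<close> that hold in \<open>G\<close> are exactly the consequences of \<open>R\<close>; that is, the canonical map
  \<open>\<langle>I | R\<rangle> \<rightarrow> G\<close> is a well-defined isomorphism.
\<close>

definition has_presentation ::
  "('a, 'm) monoid_scheme \<Rightarrow> 'i set \<Rightarrow> ('i \<Rightarrow> 'a) \<Rightarrow> ('i word \<times> 'i word) set \<Rightarrow> bool" where
  "has_presentation G I x R \<longleftrightarrow>
     group G \<and> x ` I \<subseteq> carrier G \<and> generate G (x ` I) = carrier G \<and>
     (\<forall>u \<in> words_over I. \<forall>v \<in> words_over I.
        word_value G x u = word_value G x v \<longleftrightarrow> word_equiv I R u v)"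

definition tower_relations :: "nat \<Rightarrow> nat \<Rightarrow> (nat word \<times> nat word) set" where
  "tower_relations p n =
     {(replicate p (Gen 1), [])} \<union>
     {(replicate p (Gen i), [Gen (i - 1)]) | i. i \<in> {2..n}}"


section \<open>The rational group algebra\<close>

text \<open>
  An element \<open>\<Sum>g. f g \<cdot> g\<close> of \<open>\<rat>[G]\<close> is represented by its coefficient function \<open>f\<close>, which is
  finitely supported and vanishes off \<open>carrier G\<close>.
\<close>

definition rat_group_algebra :: "('a, 'm) monoid_scheme \<Rightarrow> ('a \<Rightarrow> rat) ring" where
  "rat_group_algebra G =
     \<lparr> carrier = {f. finite {g. f g \<noteq> 0} \<and> {g. f g \<noteq> 0} \<subseteq> carrier G},
       monoid.mult = (\<lambda>f h g. \<Sum>(a, b) \<in> {(a, b). f a \<noteq> 0 \<and> h b \<noteq> 0 \<and> a \<otimes>\<^bsub>G\<^esub> b = g}. f a * h b),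
       one = (\<lambda>g. if g = \<one>\<^bsub>G\<^esub> then 1 else 0),
       ring.zero = (\<lambda>g. 0),
       add = (\<lambda>f h g. f g + h g) \<rparr>"

definition group_elem :: "'a \<Rightarrow> 'a \<Rightarrow> rat" where
  "group_elem a = (\<lambda>g. if g = a then 1 else 0)"

definition e_avg :: "('a, 'm) monoid_scheme \<Rightarrow> nat \<Rightarrow> 'a \<Rightarrow> ('a \<Rightarrow> rat)" where
  "e_avg G p a = (\<lambda>g. (\<Sum>k<p. group_elem (a [^]\<^bsub>G\<^esub> k) g) / of_nat p)"

definition e_compl :: "('a, 'm) monoid_scheme \<Rightarrow> nat \<Rightarrow> 'a \<Rightarrow> ('a \<Rightarrow> rat)" where
  "e_compl G p a = \<one>\<^bsub>rat_group_algebra G\<^esub> \<ominus>\<^bsub>rat_group_algebra G\<^esub> e_avg G p a"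

definition e_seq ::
  "('a, 'm) monoid_scheme \<Rightarrow> nat \<Rightarrow> nat \<Rightarrow> (nat \<Rightarrow> 'a) \<Rightarrow> nat \<Rightarrow> ('a \<Rightarrow> rat)" where
  "e_seq G p n x i =
     (if i = 0 then (\<Otimes>\<^bsub>rat_group_algebra G\<^esub> j \<in> {1..n}. e_avg G p (x j))
      else (\<Otimes>\<^bsub>rat_group_algebra G\<^esub> j \<in> {1..<i}. e_avg G p (x j))
             \<otimes>\<^bsub>rat_group_algebra G\<^esub> e_compl G p (x i))"


section \<open>Primitive central idempotents\<close>

definition central_idempotent :: "('a, 'm) ring_scheme \<Rightarrow> 'a \<Rightarrow> bool" where
  "central_idempotent R e \<longleftrightarrow>
     e \<in> carrier R \<and> e \<otimes>\<^bsub>R\<^esub> e = e \<and> (\<forall>a \<in> carrier R. a \<otimes>\<^bsub>R\<^esub> e = e \<otimes>\<^bsub>R\<^esub> a)"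

definition primitive_central_idempotent :: "('a, 'm) ring_scheme \<Rightarrow> 'a \<Rightarrow> bool" where
  "primitive_central_idempotent R e \<longleftrightarrow>
     central_idempotent R e \<and> e \<noteq> \<zero>\<^bsub>R\<^esub> \<and>
     \<not> (\<exists>f h. central_idempotent R f \<and> central_idempotent R h \<and>
           f \<noteq> \<zero>\<^bsub>R\<^esub> \<and> h \<noteq> \<zero>\<^bsub>R\<^esub> \<and> f \<otimes>\<^bsub>R\<^esub> h = \<zero>\<^bsub>R\<^esub> \<and> e = f \<oplus>\<^bsub>R\<^esub> h)"

end

(*
  Let y = x_n and N = p^n. Evaluation at y identifies Q[G] with Q[X]/(X^N - 1), and e_{x_j} is the
  image of Psi_j / p with Psi_j = 1 + X^m + ... + X^((p-1)m), m = p^(n-j). With E_i = e_{x_1} ... e_{x_i}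
  we have x_i E_i = E_i, so E_i E_j = E_max(i,j), and e_i = E_(i-1) - E_i for i > 0, e_0 = E_n; hence the e_i are
  orthogonal idempotents with sum 1. Moreover e_i is killed by Psi_i (and e_0 by X - 1), which is
  irreducible over Q by Eisenstein's criterion applied to Psi_i(X + 1). So each e_i Q[G] is a quotient of a
  field, and an idempotent f satisfies f e_i = 0 or f e_i = e_i; this forces the e_i to be
  precisely the primitive idempotents.
*)

theory Submission
  imports Defs "HOL-Computational_Algebra.Polynomial_Factorial"
begin

text \<open>The identities rest on a telescoping product: (X^(p^(n-i)) - 1) E_i = p^(-i) (X^(p^n) -
  1) in Q[X]. Read modulo X^(p^n) - 1, it says that multiplication by E_i sees polynomials only
  modulo X^(p^(n-i)) - 1, where every E_j with j <= i is congruent to 1; orthogonality and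
  annihilation are consequences of such congruences. Read for degrees, it gives deg E_i = p^n -
  p^(n-i), so the chosen representatives of the e_i are nonzero of degree below p^n and survive
  evaluation at y. The kernel of evaluation is never computed: it suffices that it contains X^N - 1
  and no nonzero polynomial of degree below N. Eisenstein applies at the prime p because the p^j-th
  power map is additive modulo p, which turns Psi_i(X + 1) into X^((p-1)m), while its constant term
  is Psi_i(1) = p. The field is not built as a quotient ring; a Bezout identity between Psi_i and a
  polynomial lift of the idempotent f does its work.\<close>

section \<open>Eisenstein's criterion over the integers\<close>

text \<open>At the least \<open>i\<close> with \<open>q\<close> not dividing
  \<open>coeff a i\<close>, the coefficient of \<open>a * b\<close> is
  \<open>coeff a i * coeff b 0\<close> modulo \<open>q\<close>, hence not divisible by
  \<open>q\<close>. So \<open>i\<close> is at least the degree of the product, yet at most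
  \<open>degree a\<close>.\<close>

lemma eisenstein_factor:
  fixes a b :: "int poly" and q :: int
  assumes q: "Factorial_Ring.prime q"
    and low: "\<And>i. i < degree (a * b) \<Longrightarrow> q dvd coeff (a * b) i"
    and lead: "\<not> q dvd coeff (a * b) (degree (a * b))"
    and a0: "q dvd coeff a 0" and b0: "\<not> q dvd coeff b 0"
  shows "degree b = 0"
proof -
  have nz: "a \<noteq> 0" "b \<noteq> 0" using lead by auto
  have "\<not> q dvd coeff a (degree a)"
    using lead nz by (auto simp: degree_mult_eq coeff_mult_degree_sum)
  then have ex: "\<exists>i. \<not> q dvd coeff a i" by blast
  define i where "i = (LEAST i. \<not> q dvd coeff a i)"
  have i: "\<not> q dvd coeff a i" and below: "\<And>j. j < i \<Longrightarrow> q dvd coeff a j"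
    unfolding i_def using LeastI_ex[OF ex] not_less_Least by blast+
  have "coeff (a * b) i = coeff a i * coeff b 0 + (\<Sum>j<i. coeff a j * coeff b (i - j))"
    unfolding coeff_mult lessThan_Suc_atMost[symmetric] by simp
  moreover have "q dvd (\<Sum>j<i. coeff a j * coeff b (i - j))"
    using below by (intro dvd_sum) auto
  moreover have "\<not> q dvd coeff a i * coeff b 0"
    using i b0 q by (simp add: prime_dvd_mult_iff)
  ultimately have "\<not> q dvd coeff (a * b) i" by (simp add: dvd_add_left_iff)
  then have "degree a + degree b \<le> i" using low[of i] nz by (force simp: degree_mult_eq)
  moreover have "i \<le> degree a" using i by (metis dvd_0_right le_degree)
  ultimately show ?thesis by simp
qed

text \<open>The constant term is divisible by \<open>q\<close> but not by its square, so exactly one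
  of the two factors has constant term divisible by \<open>q\<close>; the other factor is then
  constant.\<close>

lemma eisenstein:
  fixes a b :: "int poly" and q :: int
  assumes q: "Factorial_Ring.prime q"
    and low: "\<And>i. i < degree (a * b) \<Longrightarrow> q dvd coeff (a * b) i"
    and lead: "\<not> q dvd coeff (a * b) (degree (a * b))"
    and const: "\<not> q\<^sup>2 dvd coeff (a * b) 0"
  shows "degree a = 0 \<or> degree b = 0"
proof (cases "degree (a * b) = 0")
  case True
  then show ?thesis using lead by (cases "a = 0 \<or> b = 0") (auto simp: degree_mult_eq)
next
  case False
  then have "q dvd coeff a 0 * coeff b 0" using low[of 0] by (simp add: coeff_mult)
  moreover have "\<not> (q dvd coeff a 0 \<and> q dvd coeff b 0)"
    using const by (auto simp: coeff_mult power2_eq_square intro: mult_dvd_mono)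
  ultimately consider "q dvd coeff a 0" "\<not> q dvd coeff b 0" | "q dvd coeff b 0" "\<not> q dvd coeff a 0"
    using q by (auto simp: prime_dvd_mult_iff)
  then show ?thesis
  proof cases
    case 1
    then have "degree b = 0" using q low lead by (intro eisenstein_factor[of q a b])
    then show ?thesis ..
  next
    case 2
    then have "degree a = 0"
      using q low lead by (intro eisenstein_factor[of q b a]) (simp_all add: mult.commute[of b a])
    then show ?thesis ..
  qed
qed

section \<open>Gauss's lemma: from the integers to the rationals\<close>

lemma map_poly_of_int_mult:
  "map_poly (of_int :: int \<Rightarrow> rat) (f * g) = map_poly of_int f * map_poly of_int g"
  by (simp add: poly_eq_iff coeff_map_poly coeff_mult)

lemma degree_map_poly_of_int [simp]: "degree (map_poly (of_int :: int \<Rightarrow> rat) f) = degree f"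
  by (rule degree_map_poly) simp

lemma map_poly_of_int_inject [simp]:
  "map_poly (of_int :: int \<Rightarrow> rat) f = map_poly of_int g \<longleftrightarrow> f = g"
  by (simp add: poly_eq_iff coeff_map_poly)

lemma clear_denominators:
  fixes f :: "rat poly"
  obtains d :: int and g :: "int poly" where "d \<noteq> 0" "smult (of_int d) f = map_poly of_int g"
proof -
  have "\<exists>d::int. d \<noteq> 0 \<and> (\<exists>g. smult (of_int d) f = map_poly of_int g)"
  proof (induction f)
    case 0
    then show ?case by (intro exI[of _ "1::int"] conjI exI[of _ "0::int poly"]) auto
  next
    case (pCons a f)
    then obtain d g where d: "d \<noteq> 0" "smult (of_int d) f = map_poly of_int g" by blast
    obtain r s where rs: "quotient_of a = (r, s)" by fastforce
    then have s: "s > 0" and a: "a = of_int r / of_int s"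
      using quotient_of_denom_pos quotient_of_div by blast+
    have "smult (of_int (s * d)) (pCons a f) = pCons (of_int (d * r)) (smult (of_int s) (smult (of_int d) f))"
      using s by (simp add: a field_simps)
    also have "\<dots> = map_poly of_int (pCons (d * r) (smult s g))"
      unfolding d by (simp add: poly_eq_iff coeff_map_poly coeff_pCons split: nat.splits)
    finally show ?case using s d by (intro exI[of _ "s * d"]) auto
  qed
  then show ?thesis using that by blast
qed

text \<open>Clearing denominators turns a rational factorization into
  \<open>smult (c * d) f = a' * b'\<close>. As \<open>f\<close> has content 1, comparing contents
  shows that \<open>c * d\<close> cancels up to sign, leaving an integer factorization of
  \<open>f\<close> with factors of the same degrees.\<close>

lemma irreducible_int_imp_irreducible_rat:
  fixes f :: "int poly"
  assumes content: "content f = 1" and deg: "degree f > 0"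
    and factor: "\<And>a b. f = a * b \<Longrightarrow> degree a = 0 \<or> degree b = 0"
  shows "Factorial_Ring.irreducible (map_poly (of_int :: int \<Rightarrow> rat) f)"
proof (rule Factorial_Ring.irreducibleI)
  show "map_poly (of_int :: int \<Rightarrow> rat) f \<noteq> 0" using deg degree_map_poly_of_int[of f] by force
  show "\<not> is_unit (map_poly (of_int :: int \<Rightarrow> rat) f)"
  proof
    assume "is_unit (map_poly (of_int :: int \<Rightarrow> rat) f)"
    then obtain c where "map_poly (of_int :: int \<Rightarrow> rat) f = [:c:]" unfolding is_unit_poly_iff by blast
    then have "degree (map_poly (of_int :: int \<Rightarrow> rat) f) = 0" by (simp only: degree_pCons_0)
    then show False using deg by simp
  qed
  fix a b :: "rat poly"
  assume ab: "map_poly of_int f = a * b"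
  have nz: "a \<noteq> 0" "b \<noteq> 0" using ab deg degree_map_poly_of_int[of f] by force+
  obtain c a' where a: "c \<noteq> 0" "smult (of_int c) a = map_poly of_int a'" by (rule clear_denominators)
  obtain d b' where b: "d \<noteq> 0" "smult (of_int d) b = map_poly of_int b'" by (rule clear_denominators)
  have "map_poly (of_int :: int \<Rightarrow> rat) (smult (c * d) f) = smult (of_int (c * d)) (a * b)"
    unfolding ab[symmetric] by (simp add: poly_eq_iff coeff_map_poly)
  also have "\<dots> = map_poly of_int (a' * b')"
    unfolding map_poly_of_int_mult a(2)[symmetric] b(2)[symmetric] by (simp add: mult.commute)
  finally have eq: "smult (c * d) f = a' * b'" by simp
  have "\<bar>c * d\<bar> = content a' * content b'"
    using arg_cong[OF eq, of content] content by (simp add: content_mult)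
  moreover have "a' * b' = smult (content a' * content b') (primitive_part a' * primitive_part b')"
  proof -
    have "smult (content a') (primitive_part a') * smult (content b') (primitive_part b')
        = smult (content a' * content b') (primitive_part a' * primitive_part b')"
      by (simp only: mult_smult_left mult_smult_right smult_smult mult.commute)
    then show ?thesis by (simp only: content_times_primitive_part)
  qed
  ultimately have "smult (c * d) f = smult \<bar>c * d\<bar> (primitive_part a' * primitive_part b')"
    by (simp only: eq)
  \<comment> \<open>Contents are nonnegative and determine only the absolute value of
    \<open>c * d\<close>; the sign is moved into the first factor.\<close>
  then have "smult (c * d) f = smult (c * d) (smult (sgn (c * d)) (primitive_part a') * primitive_part b')"
    by (simp only: abs_sgn mult_smult_left smult_smult)
  then have "smult (c * d) (f - smult (sgn (c * d)) (primitive_part a') * primitive_part b') = 0"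
    by (simp only: smult_diff_right diff_self)
  then have "f = smult (sgn (c * d)) (primitive_part a') * primitive_part b'"
    using a(1) b(1) by (simp only: smult_eq_0_iff mult_eq_0_iff right_minus_eq simp_thms)
  from factor[OF this] have "degree a' = 0 \<or> degree b' = 0"
    using a(1) b(1) by (auto simp: sgn_eq_0_iff)
  moreover have "degree a = degree a'" "degree b = degree b'"
    using arg_cong[OF a(2), of degree] arg_cong[OF b(2), of degree] a(1) b(1) by simp_all
  ultimately have "degree a = 0 \<or> degree b = 0" by simp
  then show "is_unit a \<or> is_unit b" using nz by (auto simp: is_unit_iff_degree)
qed

section \<open>Frobenius modulo p and irreducibility of cyclotomic polynomials of prime power
  order\<close>

text \<open>Additivity of the Frobenius map, phrased as divisibility so that it applies to
  \<open>int poly\<close> itself instead of a quotient of characteristic \<open>p\<close>.\<close>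

lemma prime_dvd_add_power:
  fixes f g :: "'a::comm_ring_1"
  assumes p: "Factorial_Ring.prime p"
  shows "of_nat p dvd (f + g) ^ p - (f ^ p + g ^ p)"
proof -
  have p0: "p > 0" using p by (rule prime_gt_0_nat)
  have "(f + g) ^ p = (\<Sum>k\<in>{..p}. of_nat (p choose k) * f ^ k * g ^ (p - k))"
    by (rule binomial_ring)
  also have "{..p} = insert 0 (insert p {0<..<p})" by auto
  also have "(\<Sum>k\<in>\<dots>. of_nat (p choose k) * f ^ k * g ^ (p - k))
      = f ^ p + g ^ p + (\<Sum>k\<in>{0<..<p}. of_nat (p choose k) * f ^ k * g ^ (p - k))"
    using p0 by (simp add: algebra_simps)
  finally have "(f + g) ^ p - (f ^ p + g ^ p) = (\<Sum>k\<in>{0<..<p}. of_nat (p choose k) * f ^ k * g ^ (p - k))"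
    by simp
  also have "of_nat p dvd \<dots>"
  proof (rule dvd_sum)
    fix k assume "k \<in> {0<..<p}"
    then have "p dvd (p choose k)" using p by (intro dvd_choose_prime) auto
    then show "of_nat p dvd of_nat (p choose k) * f ^ k * g ^ (p - k)"
      by (auto elim!: dvdE simp: mult.assoc)
  qed
  finally show ?thesis .
qed

lemma prime_dvd_add_one_power_prime_power:
  fixes f :: "'a::comm_ring_1"
  assumes p: "Factorial_Ring.prime p"
  shows "of_nat p dvd (f + 1) ^ (p ^ j) - (f ^ (p ^ j) + 1)"
proof (induction j)
  case 0
  then show ?case by simp
next
  case (Suc j)
  let ?T = "(f + 1) ^ (p ^ j)" and ?g = "f ^ (p ^ j) + 1"
  \<comment> \<open>A congruence modulo \<open>p\<close> survives the \<open>p\<close>-th power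
    because u - v divides u^p - v^p.\<close>
  have "?T - ?g dvd ?T ^ p - ?g ^ p" by (simp add: power_diff_sumr2)
  with Suc have 1: "of_nat p dvd ?T ^ p - ?g ^ p" by (rule dvd_trans)
  have 2: "of_nat p dvd ?g ^ p - ((f ^ (p ^ j)) ^ p + 1)"
    using prime_dvd_add_power[OF p, of "f ^ (p ^ j)" 1] by simp
  have "(f + 1) ^ (p ^ Suc j) - (f ^ (p ^ Suc j) + 1) = ?T ^ p - ((f ^ (p ^ j)) ^ p + 1)"
    by (simp add: power_mult[symmetric] mult.commute)
  also have "\<dots> = (?T ^ p - ?g ^ p) + (?g ^ p - ((f ^ (p ^ j)) ^ p + 1))" by simp
  also have "of_nat p dvd \<dots>" using 1 2 by (rule dvd_add)
  finally show ?case .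
qed

text \<open>For prime \<open>p\<close> and \<open>m = p\<^sup>j\<close> this is the cyclotomic polynomial of order \<open>p\<^bsup>j+1\<^esup>\<close>.\<close>

definition geom_poly :: "nat \<Rightarrow> nat \<Rightarrow> 'a::comm_ring_1 poly" where
  "geom_poly p m = (\<Sum>k<p. monom 1 (k * m))"

lemma geom_poly_mult: "(monom 1 m - 1) * geom_poly p m = monom 1 (p * m) - 1"
proof -
  have "monom 1 (k * m) = (monom 1 m :: 'a poly) ^ k" for k
    by (simp add: monom_power mult.commute)
  then show ?thesis unfolding geom_poly_def by (simp add: power_diff_1_eq)
qed

lemma degree_geom_poly:
  assumes "p > 0"
  shows "degree (geom_poly p m :: 'a::idom poly) = (p - 1) * m"
proof (cases "m = 0")
  case True
  then show ?thesis by (simp add: geom_poly_def monom_0 one_pCons[symmetric] degree_of_nat)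
next
  case False
  have c: "coeff (geom_poly p m :: 'a poly) ((p - 1) * m) = 1"
  proof -
    have "coeff (geom_poly p m :: 'a poly) ((p - 1) * m) = (\<Sum>k<p. if k = p - 1 then 1 else 0)"
      unfolding geom_poly_def coeff_sum using False by (intro sum.cong) auto
    then show ?thesis using assms by simp
  qed
  show ?thesis
  proof (rule antisym)
    show "degree (geom_poly p m :: 'a poly) \<le> (p - 1) * m"
      unfolding geom_poly_def
    proof (intro degree_sum_le)
      fix k assume "k \<in> {..<p}"
      then have "k * m \<le> (p - 1) * m" by (intro mult_right_mono) auto
      then show "degree (monom 1 (k * m) :: 'a poly) \<le> (p - 1) * m"
        using degree_monom_le le_trans by blast
    qed auto
    show "(p - 1) * m \<le> degree (geom_poly p m :: 'a poly)"
      using c by (intro le_degree) simp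
  qed
qed

text \<open>The shifted polynomial \<open>?S\<close> satisfies S ((X+1)^m - 1) = (X+1)^(pm) - 1.
  Modulo \<open>p\<close> this reads S X^m = X^(pm), so all coefficients of S below the leading one
  vanish modulo \<open>p\<close>, and Eisenstein applies.\<close>

lemma irreducible_geom_poly:
  assumes p: "Factorial_Ring.prime p" and m: "m = p ^ j"
  shows "Factorial_Ring.irreducible (geom_poly p m :: rat poly)"
proof -
  let ?F = "geom_poly p m :: int poly"
  let ?S = "pcompose ?F [:1, 1:]"
  have p1: "p > 1" using p by (rule prime_gt_1_nat)
  have m0: "m > 0" using m p1 by simp
  have X: "[:1, 1:] = monom 1 1 + (1 :: int poly)" by (simp add: monom_altdef one_pCons)
  let ?T = "(monom 1 1 + 1 :: int poly) ^ m"
  have comp: "pcompose (monom 1 k) [:1, 1:] = (monom 1 1 + 1 :: int poly) ^ k" for k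
    unfolding X[symmetric] by (induction k) (simp_all add: monom_Suc pcompose_pCons pcompose_1)
  have deg: "degree ?S = (p - 1) * m"
    using p1 by (simp add: degree_geom_poly degree_pcompose)
  have S: "?S * (?T - 1) = ?T ^ p - 1"
  proof -
    have "pcompose ((monom 1 m - 1) * ?F) [:1, 1:] = pcompose (monom 1 (p * m) - 1) [:1, 1:]"
      by (simp add: geom_poly_mult)
    then show ?thesis
      by (simp add: pcompose_mult pcompose_diff pcompose_1 comp power_mult mult.commute)
  qed
  have T: "of_nat p dvd ?T - (monom 1 m + 1)"
    using prime_dvd_add_one_power_prime_power[OF p, of "monom 1 1 :: int poly" j]
    by (simp add: m monom_power)
  have Tp: "of_nat p dvd ?T ^ p - (monom 1 (p * m) + 1)"
    using prime_dvd_add_one_power_prime_power[OF p, of "monom 1 1 :: int poly" "Suc j"]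
    by (simp add: m monom_power power_mult[symmetric] mult.commute)
  \<comment> \<open>Instead of cancelling X^m modulo \<open>p\<close>, the congruence keeps this
    factor, and the coefficients of \<open>?S\<close> are read off shifted by
    \<open>m\<close>.\<close>
  have "monom 1 m * ?S - monom 1 (p * m)
      = (?T ^ p - (monom 1 (p * m) + 1)) - (?T - (monom 1 m + 1)) * ?S"
    using S by (simp add: algebra_simps)
  also have "of_nat p dvd \<dots>" by (rule dvd_diff[OF Tp dvd_mult2[OF T]])
  finally have "[:int p:] dvd monom 1 m * ?S - monom 1 (p * m)" by (simp add: of_nat_poly)
  then have "int p dvd coeff (monom 1 m * ?S - monom 1 (p * m)) (i + m)" for i
    by (simp add: const_poly_dvd_iff)
  moreover have "coeff (monom 1 m * ?S - monom 1 (p * m)) (i + m)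
      = coeff ?S i - (if i = (p - 1) * m then 1 else 0)" for i
    using p1 by (auto simp: coeff_monom_mult algebra_simps diff_mult_distrib)
  ultimately have S_coeff: "int p dvd coeff ?S i - (if i = (p - 1) * m then 1 else 0)" for i by metis
  have S0: "coeff ?S 0 = int p"
    by (simp add: pcompose_coeff_0 geom_poly_def poly_sum poly_monom)
  have "Factorial_Ring.irreducible (map_poly (of_int :: int \<Rightarrow> rat) ?F)"
  proof (rule irreducible_int_imp_irreducible_rat)
    have "coeff ?F 0 = (\<Sum>k<p. if k = 0 then 1 else 0)"
      unfolding geom_poly_def coeff_sum using m0 by (intro sum.cong) auto
    then have "coeff ?F 0 = 1" using p1 by simp
    then show "content ?F = 1" using content_dvd_coeff[of ?F 0] by (simp only: is_unit_content_iff)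
    show "degree ?F > 0" using p1 m0 by (simp add: degree_geom_poly)
    fix a b :: "int poly"
    assume "?F = a * b"
    then have ab: "?S = pcompose a [:1, 1:] * pcompose b [:1, 1:]" by (simp add: pcompose_mult)
    have "degree (pcompose a [:1, 1:]) = 0 \<or> degree (pcompose b [:1, 1:]) = 0"
    proof (rule eisenstein[of "int p"], unfold ab[symmetric] deg S0)
      show "Factorial_Ring.prime (int p)" using p by simp
      show "int p dvd coeff ?S i" if "i < (p - 1) * m" for i
        using S_coeff[of i] that by simp
      show "\<not> int p dvd coeff ?S ((p - 1) * m)"
        using S_coeff[of "(p - 1) * m"] p1
        by (metis dvd_diff_commute dvd_diff_right_iff int_dvd_int_iff nat_dvd_1_iff_1 not_less_iff_gr_or_eq of_nat_1)
      show "\<not> (int p)\<^sup>2 dvd int p" using p1 by (auto simp: power2_eq_square dest: zdvd_imp_le)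
    qed
    then show "degree a = 0 \<or> degree b = 0" by (simp add: degree_pcompose)
  qed
  also have "map_poly (of_int :: int \<Rightarrow> rat) ?F = geom_poly p m"
    by (auto simp: poly_eq_iff coeff_map_poly geom_poly_def coeff_sum intro!: sum.cong)
  finally show ?thesis .
qed

section \<open>A Bezout alternative and primitive idempotents in a commutative ring\<close>

text \<open>This is the field property of Q[X]/(f). A nonzero element \<open>h\<close> of least
  degree in the ideal generated by \<open>f\<close> and \<open>g\<close> divides both, by division
  with remainder. If \<open>h\<close> is not a unit, irreducibility makes it an associate of
  \<open>f\<close>, so \<open>f\<close> divides \<open>g\<close>.\<close>

lemma irreducible_dvd_or_bezout:
  fixes f g :: "rat poly"
  assumes "Factorial_Ring.irreducible f"
  shows "f dvd g \<or> (\<exists>a b. a * f + b * g = 1)"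
proof (cases "f dvd g")
  case False
  define I where "I = {a * f + b * g | a b. True} - {0}"
  have "f = 1 * f + 0 * g" "f \<noteq> 0" using assms by (simp_all add: Factorial_Ring.irreducible_def)
  then have "f \<in> I" unfolding I_def by blast
  then obtain h where h: "h \<in> I" and min: "\<And>h'. h' \<in> I \<Longrightarrow> degree h \<le> degree h'"
    using ex_has_least_nat[of "\<lambda>h. h \<in> I" f degree] by blast
  obtain a b where hab: "h = a * f + b * g" using h unfolding I_def by blast
  have dvd: "h dvd u" if "u = c * f + d * g" for u c d
  proof -
    have "u mod h = (c - u div h * a) * f + (d - u div h * b) * g"
      unfolding that hab[symmetric] minus_div_mult_eq_mod[symmetric] by (simp add: hab algebra_simps)
    then have "u mod h = 0 \<or> degree h \<le> degree (u mod h)" using min[of "u mod h"] unfolding I_def by blast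
    moreover have "h \<noteq> 0" using h unfolding I_def by blast
    ultimately show ?thesis using degree_mod_less[of h u] by (auto simp: dvd_eq_mod_eq_0)
  qed
  have "h dvd f" using dvd[of f 1 0] by simp
  then obtain k where k: "f = h * k" by blast
  have "h dvd g" using dvd[of g 0 1] by simp
  have "is_unit h"
  proof (rule ccontr)
    assume "\<not> is_unit h"
    then have "is_unit k" using assms k by (meson Factorial_Ring.irreducibleD)
    then have "f dvd h" using k by (simp add: mult_unit_dvd_iff)
    then show False using \<open>h dvd g\<close> False dvd_trans by blast
  qed
  then obtain r where "h * r = 1" by (metis dvdE)
  then have "(r * a) * f + (r * b) * g = 1" using hab by (simp add: algebra_simps)
  then show ?thesis by blast
qed simp

text \<open>The dichotomy makes each \<open>e i\<close> an atom among the idempotents. Idempotence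
  of \<open>e i\<close> itself comes from multiplying the decomposition of one by \<open>e i\<close>
  and using orthogonality.\<close>

lemma (in cring) primitive_central_idempotents_eq:
  assumes I: "finite I" and e: "\<And>i. i \<in> I \<Longrightarrow> e i \<in> carrier R"
    and nz: "\<And>i. i \<in> I \<Longrightarrow> e i \<noteq> \<zero>"
    and orth: "\<And>i j. i \<in> I \<Longrightarrow> j \<in> I \<Longrightarrow> i \<noteq> j \<Longrightarrow> e i \<otimes> e j = \<zero>"
    and sum: "(\<Oplus>i\<in>I. e i) = \<one>"
    and dichotomy: "\<And>f i. f \<in> carrier R \<Longrightarrow> f \<otimes> f = f \<Longrightarrow> i \<in> I \<Longrightarrow> f \<otimes> e i = \<zero> \<or> f \<otimes> e i = e i"
  shows "e ` I = {f. primitive_central_idempotent R f}"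
proof -
  have central: "central_idempotent R f \<longleftrightarrow> f \<in> carrier R \<and> f \<otimes> f = f" for f
    unfolding central_idempotent_def using m_comm by blast
  have expand: "a = (\<Oplus>i\<in>I. a \<otimes> e i)" if "a \<in> carrier R" for a
  proof -
    have "a = a \<otimes> (\<Oplus>i\<in>I. e i)" unfolding sum using that by simp
    also have "\<dots> = (\<Oplus>i\<in>I. a \<otimes> e i)" using I that e by (intro finsum_rdistr) auto
    finally show ?thesis .
  qed
  have idem: "e i \<otimes> e i = e i" if i: "i \<in> I" for i
  proof -
    have "e i = (\<Oplus>j\<in>I. e i \<otimes> e j)" by (rule expand[OF e[OF i]])
    also have "\<dots> = (\<Oplus>j\<in>I. if i = j then e j \<otimes> e j else \<zero>)"
      using i e orth by (intro finsum_cong') auto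
    also have "\<dots> = e i \<otimes> e i"
      using I i e by (intro add.finprod_singleton) auto
    finally show ?thesis
      \<comment> \<open>an unqualified \<open>refl\<close>, \<open>sym\<close> or \<open>trans\<close> is an introduction rule of \<open>word_equiv\<close>\<close>
      by (rule HOL.sym)
  qed
  show ?thesis
  proof (intro equalityI subsetI)
    fix f assume "f \<in> e ` I"
    then obtain i where i: "i \<in> I" "f = e i" by blast
    have False if g: "central_idempotent R g" "g \<noteq> \<zero>" and h: "central_idempotent R h" "h \<noteq> \<zero>"
      and gh: "g \<otimes> h = \<zero>" "e i = g \<oplus> h" for g h
    proof -
      have gR: "g \<in> carrier R" "g \<otimes> g = g" and hR: "h \<in> carrier R" "h \<otimes> h = h"
        using g h central by auto
      have hg: "h \<otimes> g = \<zero>" using m_comm[OF hR(1) gR(1)] gh by simp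
      \<comment> \<open>Each summand absorbs \<open>e i\<close> since the mixed products vanish.
        Being nonzero, both equal \<open>e i\<close> by the dichotomy, so their product would be
        \<open>e i\<close> and not zero.\<close>
      have "g \<otimes> e i = g" "h \<otimes> e i = h" using gR hR gh hg by (simp_all add: r_distr)
      then have "g = e i" "h = e i"
        using dichotomy[OF gR i(1)] dichotomy[OF hR i(1)] g(2) h(2) by metis+
      then have "e i \<otimes> e i = \<zero>" using gh(1) by blast
      then show False using idem[OF i(1)] nz[OF i(1)] by metis
    qed
    then have "\<not> (\<exists>g h. central_idempotent R g \<and> central_idempotent R h \<and> g \<noteq> \<zero> \<and> h \<noteq> \<zero> \<and>
        g \<otimes> h = \<zero> \<and> e i = g \<oplus> h)" by blast
    moreover have "central_idempotent R (e i)" using central e[OF i(1)] idem[OF i(1)] by blast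
    ultimately show "f \<in> {f. primitive_central_idempotent R f}"
      unfolding primitive_central_idempotent_def i(2) using nz[OF i(1)] by blast
  next
    fix f assume "f \<in> {f. primitive_central_idempotent R f}"
    then have f: "f \<in> carrier R" "f \<otimes> f = f" "f \<noteq> \<zero>"
      and prim: "\<And>g h. central_idempotent R g \<Longrightarrow> central_idempotent R h \<Longrightarrow> g \<noteq> \<zero> \<Longrightarrow> h \<noteq> \<zero> \<Longrightarrow>
        g \<otimes> h = \<zero> \<Longrightarrow> f \<noteq> g \<oplus> h"
      unfolding primitive_central_idempotent_def central[symmetric] using central by blast+
    have "\<exists>i\<in>I. f \<otimes> e i \<noteq> \<zero>"
    proof (rule ccontr)
      assume "\<not> ?thesis"
      then have "(\<Oplus>i\<in>I. f \<otimes> e i) = \<zero>" by (intro add.finprod_one_eqI) auto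
      then show False using HOL.trans[OF expand[OF f(1)]] f(3) by blast
    qed
    then obtain i where i: "i \<in> I" and fe: "f \<otimes> e i = e i" using dichotomy f by blast
    \<comment> \<open>Splitting off \<open>e i\<close> from \<open>f\<close> leaves an idempotent
      orthogonal to \<open>e i\<close>, which primitivity of \<open>f\<close> forces to
      vanish.\<close>
    let ?h = "f \<ominus> e i"
    have eR: "e i \<in> carrier R" and hR: "?h \<in> carrier R" using e i f by auto
    have ef: "e i \<otimes> f = e i" using fe m_comm[OF eR f(1)] by simp
    have eh: "e i \<otimes> ?h = \<zero>"
      using eR f(1) ef idem[OF i] by (simp add: minus_eq r_distr r_minus r_neg)
    have fh: "f \<otimes> ?h = ?h"
      using eR f(1,2) fe by (simp add: minus_eq r_distr r_minus)
    have "?h \<otimes> ?h = f \<otimes> ?h \<ominus> e i \<otimes> ?h"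
      using eR f(1) hR by (simp add: minus_eq l_distr l_minus)
    then have hh: "?h \<otimes> ?h = ?h" using eh fh hR by (simp add: minus_eq)
    have "f = e i \<oplus> ?h" using eR f(1) by (simp add: minus_eq a_comm[of f] r_neg2)
    then have "?h = \<zero>"
      using prim[of "e i" ?h] central[THEN iffD2, OF conjI[OF eR idem[OF i]]]
        central[THEN iffD2, OF conjI[OF hR hh]] eh nz[OF i] by blast
    then have "f = e i" using eR f(1) by (simp add: r_right_minus_eq)
    then show "f \<in> e ` I" using i by blast
  qed
qed

section \<open>The group algebra of a finite cyclic group as an image of Q[X]\<close>

text \<open>Reduces additive statements to monomials; zero is the monomial with
  \<open>c = 0\<close>, so there is no separate base case.\<close>

lemma poly_add_monom_induct [case_names monom add]:
  assumes "\<And>c k. P (monom c k)" "\<And>f g. P f \<Longrightarrow> P g \<Longrightarrow> P (f + g)"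
  shows "P f"
proof -
  have "P (\<Sum>i\<le>m. monom (coeff f i) i)" for m
    by (induction m) (simp_all add: assms)
  then show ?thesis using poly_as_sum_of_monoms[of f] by metis
qed

lemma carrier_rat_group_algebra:
  "carrier (rat_group_algebra G) = {f. finite {g. f g \<noteq> 0} \<and> {g. f g \<noteq> 0} \<subseteq> carrier G}"
  by (simp add: rat_group_algebra_def)

lemma add_rat_group_algebra: "f \<oplus>\<^bsub>rat_group_algebra G\<^esub> h = (\<lambda>g. f g + h g)"
  by (simp add: rat_group_algebra_def)

lemma zero_rat_group_algebra: "\<zero>\<^bsub>rat_group_algebra G\<^esub> = (\<lambda>g. 0)"
  by (simp add: rat_group_algebra_def)

lemma one_rat_group_algebra: "\<one>\<^bsub>rat_group_algebra G\<^esub> = (\<lambda>g. if g = \<one>\<^bsub>G\<^esub> then 1 else 0)"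
  by (simp add: rat_group_algebra_def)

text \<open>The defining sum ranges over a set of pairs that varies with \<open>f\<close> and
  \<open>h\<close>. Over a finite group the range can be fixed, which makes bilinearity
  visible.\<close>

lemma mult_rat_group_algebra:
  assumes "finite (carrier G)" "f \<in> carrier (rat_group_algebra G)" "h \<in> carrier (rat_group_algebra G)"
  shows "(f \<otimes>\<^bsub>rat_group_algebra G\<^esub> h) g =
    (\<Sum>a\<in>carrier G. \<Sum>b\<in>carrier G. if a \<otimes>\<^bsub>G\<^esub> b = g then f a * h b else 0)"
proof -
  have "(f \<otimes>\<^bsub>rat_group_algebra G\<^esub> h) g =
      (\<Sum>(a, b)\<in>{(a, b). f a \<noteq> 0 \<and> h b \<noteq> 0 \<and> a \<otimes>\<^bsub>G\<^esub> b = g}. f a * h b)"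
    by (simp add: rat_group_algebra_def)
  also have "\<dots> = (\<Sum>(a, b)\<in>carrier G \<times> carrier G. if a \<otimes>\<^bsub>G\<^esub> b = g then f a * h b else 0)"
  proof (intro sum.mono_neutral_cong_left)
    show "finite (carrier G \<times> carrier G)" using assms(1) by simp
    show "{(a, b). f a \<noteq> 0 \<and> h b \<noteq> 0 \<and> a \<otimes>\<^bsub>G\<^esub> b = g} \<subseteq> carrier G \<times> carrier G"
      using assms(2,3) unfolding carrier_rat_group_algebra by blast
  qed (auto split: if_splits)
  finally show ?thesis by (simp add: sum.cartesian_product)
qed

text \<open>\<open>bij\<close> makes evaluation at \<open>y\<close> surjective, and injective in
  degrees below \<open>N\<close>; \<open>y_N\<close> puts X^N - 1 into its kernel.\<close>

locale generated_cyclic_group = group G for G (structure) +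
  fixes y and N :: nat
  assumes y: "y \<in> carrier G"
    and bij: "bij_betw (\<lambda>i. y [^] i) {..<N} (carrier G)"
    and y_N: "y [^] N = \<one>"
begin

abbreviation "A \<equiv> rat_group_algebra G"

text \<open>The substitution \<open>X \<mapsto> y\<close>, which induces \<open>\<rat>[X]/(X\<^sup>N - 1) \<cong> \<rat>[G]\<close>.\<close>

definition ev :: "rat poly \<Rightarrow> 'a \<Rightarrow> rat" where
  "ev P = (\<lambda>g. \<Sum>i\<le>degree P. if y [^] i = g then coeff P i else 0)"

lemma finite_carrier: "finite (carrier G)"
  using bij bij_betw_finite by blast

lemma ev_eq: "degree P \<le> d \<Longrightarrow> ev P g = (\<Sum>i\<le>d. if y [^] i = g then coeff P i else 0)"
  unfolding ev_def by (intro sum.mono_neutral_cong_left) (auto simp: coeff_eq_0)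

lemma ev_closed [simp]: "ev P \<in> carrier A"
proof -
  have "g \<in> carrier G" if "ev P g \<noteq> 0" for g
  proof (rule ccontr)
    assume "g \<notin> carrier G"
    then have "y [^] i \<noteq> g" for i :: nat using y by auto
    then show False using that by (simp add: ev_def)
  qed
  then show ?thesis
    unfolding carrier_rat_group_algebra using finite_carrier by (auto intro: finite_subset)
qed

lemma ev_monom: "ev (monom c k) = (\<lambda>g. if y [^] k = g then c else 0)"
proof
  fix g
  have "ev (monom c k) g = (\<Sum>i\<le>k. if y [^] i = g then coeff (monom c k) i else 0)"
    by (intro ev_eq degree_monom_le)
  also have "\<dots> = (\<Sum>i\<le>k. if i = k then (if y [^] k = g then c else 0) else 0)"
    by (intro sum.cong) auto
  finally show "ev (monom c k) g = (if y [^] k = g then c else 0)" by simp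
qed

lemma ev_add: "ev (P + Q) = ev P \<oplus>\<^bsub>A\<^esub> ev Q"
proof
  fix g
  let ?d = "max (degree P) (degree Q)"
  show "ev (P + Q) g = (ev P \<oplus>\<^bsub>A\<^esub> ev Q) g"
    by (simp add: ev_eq[of _ ?d] degree_add_le add_rat_group_algebra sum.distrib[symmetric] if_distrib
        cong: if_cong)
qed

lemma ev_0: "ev 0 = \<zero>\<^bsub>A\<^esub>"
  by (simp add: ev_def zero_rat_group_algebra cong: if_cong)

lemma ev_1: "ev 1 = \<one>\<^bsub>A\<^esub>"
  using ev_monom[of 1 0] by (auto simp: one_rat_group_algebra monom_0 one_pCons)

lemma ev_sum: "finite I \<Longrightarrow> ev (\<Sum>i\<in>I. P i) = (\<lambda>g. \<Sum>i\<in>I. ev (P i) g)"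
  by (induction I rule: finite_induct) (simp_all add: ev_0 ev_add zero_rat_group_algebra add_rat_group_algebra)

text \<open>Closure of the sum is a hypothesis because the ring structure of \<open>A\<close> is
  derived only later, from \<open>ev\<close>; for images under \<open>ev\<close> it follows from
  \<open>ev_add\<close>.\<close>

lemma mult_add_left:
  assumes "f \<in> carrier A" "f' \<in> carrier A" "h \<in> carrier A" "f \<oplus>\<^bsub>A\<^esub> f' \<in> carrier A"
  shows "(f \<oplus>\<^bsub>A\<^esub> f') \<otimes>\<^bsub>A\<^esub> h = f \<otimes>\<^bsub>A\<^esub> h \<oplus>\<^bsub>A\<^esub> f' \<otimes>\<^bsub>A\<^esub> h"
proof
  fix g
  have "((f \<oplus>\<^bsub>A\<^esub> f') \<otimes>\<^bsub>A\<^esub> h) g = (\<Sum>a\<in>carrier G. \<Sum>b\<in>carrier G.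
      (if a \<otimes> b = g then f a * h b else 0) + (if a \<otimes> b = g then f' a * h b else 0))"
    unfolding mult_rat_group_algebra[OF finite_carrier assms(4,3)]
    unfolding add_rat_group_algebra
    by (intro sum.cong) (simp_all add: distrib_right)
  also have "\<dots> = (f \<otimes>\<^bsub>A\<^esub> h \<oplus>\<^bsub>A\<^esub> f' \<otimes>\<^bsub>A\<^esub> h) g"
    unfolding add_rat_group_algebra mult_rat_group_algebra[OF finite_carrier assms(1,3)]
      mult_rat_group_algebra[OF finite_carrier assms(2,3)]
    by (simp only: sum.distrib)
  finally show "((f \<oplus>\<^bsub>A\<^esub> f') \<otimes>\<^bsub>A\<^esub> h) g = (f \<otimes>\<^bsub>A\<^esub> h \<oplus>\<^bsub>A\<^esub> f' \<otimes>\<^bsub>A\<^esub> h) g" .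
qed

lemma mult_comm:
  assumes "f \<in> carrier A" "h \<in> carrier A"
  shows "f \<otimes>\<^bsub>A\<^esub> h = h \<otimes>\<^bsub>A\<^esub> f"
proof
  fix g
  have comm: "a \<otimes> b = b \<otimes> a" if ab: "a \<in> carrier G" "b \<in> carrier G" for a b
  proof -
    obtain i j :: nat where "a = y [^] i" "b = y [^] j" using ab
      unfolding bij_betw_imp_surj_on[OF bij, symmetric] by blast
    then show ?thesis using y by (simp add: nat_pow_mult add.commute)
  qed
  show "(f \<otimes>\<^bsub>A\<^esub> h) g = (h \<otimes>\<^bsub>A\<^esub> f) g"
    unfolding mult_rat_group_algebra[OF finite_carrier assms]
      mult_rat_group_algebra[OF finite_carrier assms(2,1)]
    by (subst sum.swap) (intro sum.cong; simp add: comm mult.commute)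
qed

text \<open>Both sides are additive in \<open>P\<close> and in \<open>Q\<close>, so only monomials
  matter, and there the claim is addition of exponents of \<open>y\<close>.\<close>

lemma ev_mult: "ev (P * Q) = ev P \<otimes>\<^bsub>A\<^esub> ev Q"
proof (induction P rule: poly_add_monom_induct)
  case (monom c k)
  show ?case
  proof (induction Q rule: poly_add_monom_induct)
    case (monom d l)
    have "(ev (monom c k) \<otimes>\<^bsub>A\<^esub> ev (monom d l)) g = ev (monom (c * d) (k + l)) g" for g
    proof -
      have "(ev (monom c k) \<otimes>\<^bsub>A\<^esub> ev (monom d l)) g
          = (\<Sum>a\<in>carrier G. \<Sum>b\<in>carrier G. if a \<otimes> b = g then ev (monom c k) a * ev (monom d l) b else 0)"
        by (intro mult_rat_group_algebra finite_carrier ev_closed)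
      \<comment> \<open>The conditions are nested with the equations for \<open>b\<close> and
        \<open>a\<close> outermost, so that both sums collapse to a single term.\<close>
      also have "\<dots> = (\<Sum>a\<in>carrier G. \<Sum>b\<in>carrier G.
          if b = y [^] l then (if a = y [^] k then (if a \<otimes> b = g then c * d else 0) else 0) else 0)"
        by (intro sum.cong refl) (auto simp: ev_monom)
      also have "\<dots> = ev (monom (c * d) (k + l)) g"
        using y by (simp add: finite_carrier ev_monom nat_pow_mult)
      finally show ?thesis .
    qed
    then show ?case by (simp add: mult_monom fun_eq_iff)
  next
    case (add Q Q')
    moreover have "ev Q \<oplus>\<^bsub>A\<^esub> ev Q' \<in> carrier A" by (simp flip: ev_add)
    ultimately show ?case by (simp add: distrib_left ev_add mult_add_left mult_comm[of "ev (monom c k)"])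
  qed
next
  case (add P P')
  moreover have "ev P \<oplus>\<^bsub>A\<^esub> ev P' \<in> carrier A" by (simp flip: ev_add)
  ultimately show ?case by (simp add: distrib_right ev_add mult_add_left)
qed

lemma ev_surj:
  assumes "f \<in> carrier A"
  obtains P where "f = ev P"
proof
  show "f = ev (\<Sum>i<N. monom (f (y [^] i)) i)"
  proof
    fix g
    have eq: "ev (\<Sum>i<N. monom (f (y [^] i)) i) g = (\<Sum>i<N. if y [^] i = g then f g else 0)"
      by (auto simp: ev_sum ev_monom intro!: sum.cong)
    show "f g = ev (\<Sum>i<N. monom (f (y [^] i)) i) g"
    proof (cases "g \<in> carrier G")
      case True
      then obtain j where j: "j < N" "g = y [^] j" using bij by (auto simp: bij_betw_def)
      have "(\<Sum>i<N. if y [^] i = g then f g else 0) = (\<Sum>i<N. if i = j then f g else 0)"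
        using j bij by (intro sum.cong) (auto simp: bij_betw_def inj_on_def)
      then show ?thesis using j eq by simp
    next
      case False
      then have "f g = 0" using assms by (auto simp: carrier_rat_group_algebra)
      then show ?thesis by (simp add: eq cong: if_cong)
    qed
  qed
qed

text \<open>Every element is a value of \<open>ev\<close>, which respects sums and products, so the
  ring laws are inherited from Q[X] without computing convolutions.\<close>

sublocale alg: cring A
proof (intro cringI abelian_groupI comm_monoidI)
  fix a b c assume "a \<in> carrier A" "b \<in> carrier A" "c \<in> carrier A"
  then obtain P Q S where [simp]: "a = ev P" "b = ev Q" "c = ev S" using ev_surj by metis
  show "a \<oplus>\<^bsub>A\<^esub> b \<oplus>\<^bsub>A\<^esub> c = a \<oplus>\<^bsub>A\<^esub> (b \<oplus>\<^bsub>A\<^esub> c)" by (simp add: add.assoc flip: ev_add)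
  show "a \<otimes>\<^bsub>A\<^esub> b \<otimes>\<^bsub>A\<^esub> c = a \<otimes>\<^bsub>A\<^esub> (b \<otimes>\<^bsub>A\<^esub> c)" by (simp add: mult.assoc flip: ev_mult)
  show "(a \<oplus>\<^bsub>A\<^esub> b) \<otimes>\<^bsub>A\<^esub> c = a \<otimes>\<^bsub>A\<^esub> c \<oplus>\<^bsub>A\<^esub> b \<otimes>\<^bsub>A\<^esub> c"
    by (simp add: distrib_right flip: ev_add ev_mult)
next
  fix a b assume "a \<in> carrier A" "b \<in> carrier A"
  then obtain P Q where [simp]: "a = ev P" "b = ev Q" using ev_surj by metis
  show "a \<oplus>\<^bsub>A\<^esub> b \<in> carrier A" by (simp flip: ev_add)
  show "a \<otimes>\<^bsub>A\<^esub> b \<in> carrier A" by (simp flip: ev_mult)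
  show "a \<oplus>\<^bsub>A\<^esub> b = b \<oplus>\<^bsub>A\<^esub> a" by (simp add: add.commute flip: ev_add)
  show "a \<otimes>\<^bsub>A\<^esub> b = b \<otimes>\<^bsub>A\<^esub> a" by (simp add: mult.commute flip: ev_mult)
next
  fix a assume "a \<in> carrier A"
  then obtain P where [simp]: "a = ev P" using ev_surj by metis
  show "\<zero>\<^bsub>A\<^esub> \<oplus>\<^bsub>A\<^esub> a = a" by (simp flip: ev_0 ev_add)
  show "\<one>\<^bsub>A\<^esub> \<otimes>\<^bsub>A\<^esub> a = a" by (simp flip: ev_1 ev_mult)
  have "ev (- P) \<oplus>\<^bsub>A\<^esub> a = \<zero>\<^bsub>A\<^esub>" by (simp flip: ev_0 ev_add)
  then show "\<exists>b\<in>carrier A. b \<oplus>\<^bsub>A\<^esub> a = \<zero>\<^bsub>A\<^esub>" using ev_closed by blast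
qed (simp_all flip: ev_0 ev_1)

lemma ev_diff: "ev (P - Q) = ev P \<ominus>\<^bsub>A\<^esub> ev Q"
proof -
  have "ev (P - Q) \<oplus>\<^bsub>A\<^esub> ev Q = ev P" by (simp flip: ev_add)
  then show ?thesis by (metis alg.add.inv_solve_right a_minus_def ev_closed)
qed

lemma ev_finprod: "finite I \<Longrightarrow> (\<Otimes>\<^bsub>A\<^esub>i\<in>I. ev (P i)) = ev (\<Prod>i\<in>I. P i)"
  by (induction I rule: finite_induct) (simp_all add: ev_1 ev_mult)

lemma ev_finsum: "finite I \<Longrightarrow> (\<Oplus>\<^bsub>A\<^esub>i\<in>I. ev (P i)) = ev (\<Sum>i\<in>I. P i)"
  by (induction I rule: finite_induct) (simp_all add: ev_0 ev_add)

lemma ev_eqI: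
  assumes "monom 1 N - 1 dvd P - Q"
  shows "ev P = ev Q"
proof -
  have "ev (monom 1 N) = ev (monom 1 0)" unfolding ev_monom using y_N by simp
  then have "ev (monom 1 N - 1) = \<zero>\<^bsub>A\<^esub>" by (simp add: ev_diff monom_0 one_pCons alg.r_right_minus_eq)
  moreover obtain S where S: "P - Q = (monom 1 N - 1) * S" using assms by blast
  ultimately have "ev (P - Q) = \<zero>\<^bsub>A\<^esub>" unfolding S by (simp add: ev_mult)
  then show ?thesis by (simp add: ev_diff alg.r_right_minus_eq)
qed

text \<open>Below exponent \<open>N\<close> the powers of \<open>y\<close> are distinct, so the
  value at y^(deg P) is the leading coefficient of \<open>P\<close>.\<close>

lemma ev_nonzero:
  assumes "P \<noteq> 0" "degree P < N"
  shows "ev P \<noteq> \<zero>\<^bsub>A\<^esub>"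
proof
  let ?j = "degree P"
  assume "ev P = \<zero>\<^bsub>A\<^esub>"
  then have "0 = ev P (y [^] ?j)" by (simp add: zero_rat_group_algebra)
  also have "\<dots> = (\<Sum>i\<le>?j. if i = ?j then coeff P ?j else 0)"
    unfolding ev_def using assms bij by (intro sum.cong) (auto simp: bij_betw_def inj_on_def)
  finally show False using assms by simp
qed

end

section \<open>Polynomial representatives of the idempotents modulo X^(p^n) - 1\<close>

lemma monom_minus_one_dvd:
  "(monom 1 m - 1 :: 'a::comm_ring_1 poly) dvd monom 1 (m * k) - 1"
proof -
  have "monom 1 m - 1 dvd (monom 1 m :: 'a poly) ^ k - 1" by (simp add: power_diff_1_eq)
  then show ?thesis by (simp add: monom_power)
qed

lemma degree_monom_minus_one: "m > 0 \<Longrightarrow> degree (monom 1 m - 1 :: 'a::idom poly) = m"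
  using degree_add_eq_left[of "-1 :: 'a poly" "monom 1 m"] by (simp add: degree_monom_eq)

context
  fixes p n :: nat
begin

text \<open>
  Representatives of \<open>e_avg G p (x j)\<close>, of \<open>e\<^bsub>x\<^sub>1\<^esub> \<cdots> e\<^bsub>x\<^sub>i\<^esub>\<close> and of \<open>e_seq G p n x i\<close> under \<open>x j = y ^ p ^ (n - j)\<close>.
\<close>

definition avg_poly :: "nat \<Rightarrow> rat poly" where
  "avg_poly j = smult (1 / of_nat p) (geom_poly p (p ^ (n - j)))"

definition avg_prod :: "nat \<Rightarrow> rat poly" where
  "avg_prod i = (\<Prod>j\<in>{1..i}. avg_poly j)"

definition idem_poly :: "nat \<Rightarrow> rat poly" where
  "idem_poly i = (if i = 0 then avg_prod n else avg_prod (i - 1) - avg_prod i)"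

text \<open>For prime \<open>p\<close>, the cyclotomic polynomial of order p^(n-i+1) if 1 <= i <= n,
  and of order 1 if i = 0: the irreducible factor of X^(p^n) - 1 attached to
  \<open>idem_poly i\<close>.\<close>

definition annihilator_poly :: "nat \<Rightarrow> rat poly" where
  "annihilator_poly i = (if i = 0 then monom 1 1 - 1 else geom_poly p (p ^ (n - i)))"

lemma avg_prod_0 [simp]: "avg_prod 0 = 1"
  by (simp add: avg_prod_def)

lemma avg_prod_Suc: "avg_prod (Suc i) = avg_prod i * avg_poly (Suc i)"
  by (simp add: avg_prod_def)

text \<open>The product telescopes: by \<open>geom_poly_mult\<close>, the \<open>i\<close>-th factor
  replaces the exponent p^(n-i) by p^(n-i+1) and contributes 1/p.\<close>

lemma avg_prod_mult:
  assumes "i \<le> n"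
  shows "(monom 1 (p ^ (n - i)) - 1) * avg_prod i = smult (1 / of_nat p ^ i) (monom 1 (p ^ n) - 1)"
  using assms
proof (induction i)
  case 0
  then show ?case by simp
next
  case (Suc i)
  have "p * p ^ (n - Suc i) = p ^ (n - i)" using Suc.prems by (simp add: Suc_diff_Suc flip: power_Suc)
  then have "(monom 1 (p ^ (n - Suc i)) - 1) * avg_poly (Suc i)
      = smult (1 / of_nat p) (monom 1 (p ^ (n - i)) - 1)"
    by (simp add: avg_poly_def geom_poly_mult)
  then have "(monom 1 (p ^ (n - Suc i)) - 1) * avg_prod (Suc i)
      = smult (1 / of_nat p) ((monom 1 (p ^ (n - i)) - 1) * avg_prod i)"
    unfolding avg_prod_Suc by (simp add: mult.left_commute mult.commute)
  also have "\<dots> = smult (1 / of_nat p ^ Suc i) (monom 1 (p ^ n) - 1)"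
    using Suc by simp
  finally show ?case .
qed

text \<open>Polynomial form of x_i E_i = E_i: whatever vanishes modulo X^(p^(n-i)) - 1 is killed by
  \<open>avg_prod i\<close>.\<close>

lemma dvd_mult_avg_prod:
  assumes "i \<le> n" "monom 1 (p ^ (n - i)) - 1 dvd f"
  shows "monom 1 (p ^ n) - 1 dvd f * avg_prod i"
proof -
  have "(monom 1 (p ^ (n - i)) - 1) * avg_prod i dvd f * avg_prod i"
    using assms(2) by (rule mult_dvd_mono) simp
  moreover have "monom 1 (p ^ n) - 1 dvd (monom 1 (p ^ (n - i)) - 1) * avg_prod i"
    using assms(1) by (simp only: avg_prod_mult dvd_smult dvd_refl)
  ultimately show ?thesis by (rule dvd_trans[rotated])
qed

text \<open>The differences telescope from \<open>avg_prod 0 = 1\<close>, so the identity holds in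
  Q[X] and not just modulo X^(p^n) - 1.\<close>

lemma sum_idem_poly: "(\<Sum>i\<in>{0..n}. idem_poly i) = 1"
proof -
  have "avg_prod m + (\<Sum>i\<in>{1..m}. avg_prod (i - 1) - avg_prod i) = 1" for m
    by (induction m) simp_all
  from this[of n] have "avg_prod n + (\<Sum>i\<in>{1..n}. idem_poly i) = 1"
    by (simp add: idem_poly_def)
  then show ?thesis by (simp add: sum.atLeast_Suc_atMost idem_poly_def[of 0])
qed

context
  assumes p: "Factorial_Ring.prime p"
begin

text \<open>The exponent p^(n-i) divides p^(n-j), so \<open>avg_poly j\<close> is an average of
  \<open>p\<close> monomials each congruent to 1.\<close>

lemma avg_poly_cong_one:
  assumes "j \<le> i" "i \<le> n"
  shows "monom 1 (p ^ (n - i)) - 1 dvd avg_poly j - 1"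
proof -
  have p0: "p > 0" using p by (rule prime_gt_0_nat)
  have "p ^ (n - j) = p ^ (n - i) * p ^ (i - j)" using assms by (simp flip: power_add)
  then have dvd: "(monom 1 (p ^ (n - i)) - 1 :: rat poly) dvd monom 1 (k * p ^ (n - j)) - 1" for k
    using monom_minus_one_dvd[of "p ^ (n - i)" "k * p ^ (i - j)"] by (simp add: mult_ac)
  have "avg_poly j - 1 = smult (1 / of_nat p) (\<Sum>k<p. monom 1 (k * p ^ (n - j)) - 1)"
    using p0 by (simp add: avg_poly_def geom_poly_def sum_subtractf smult_diff_right of_nat_poly one_pCons)
  then show ?thesis using dvd by (auto intro!: dvd_smult dvd_sum)
qed

lemma avg_prod_cong_one:
  assumes "j \<le> i" "i \<le> n"
  shows "monom 1 (p ^ (n - i)) - 1 dvd avg_prod j - 1"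
  using assms(1)
proof (induction j)
  case (Suc j)
  have "avg_prod (Suc j) - 1 = avg_prod j * (avg_poly (Suc j) - 1) + (avg_prod j - 1)"
    by (simp add: avg_prod_Suc algebra_simps)
  moreover have "monom 1 (p ^ (n - i)) - 1 dvd avg_prod j * (avg_poly (Suc j) - 1)"
    using Suc.prems assms(2) by (intro dvd_mult avg_poly_cong_one)
  moreover have "monom 1 (p ^ (n - i)) - 1 dvd avg_prod j - 1" using Suc by simp
  ultimately show ?case by (simp only: dvd_add)
qed simp

text \<open>E_(i-1) and E_i are both congruent to 1 modulo X^(p^(n-k)) - 1, so their difference is
  killed by E_k.\<close>

lemma idem_poly_mult_avg_prod:
  assumes "1 \<le> i" "i \<le> k" "k \<le> n"
  shows "monom 1 (p ^ n) - 1 dvd idem_poly i * avg_prod k"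
proof (rule dvd_mult_avg_prod)
  have "idem_poly i = (avg_prod (i - 1) - 1) - (avg_prod i - 1)"
    using assms by (simp add: idem_poly_def)
  also have "monom 1 (p ^ (n - k)) - 1 dvd \<dots>"
    by (rule dvd_diff; rule avg_prod_cong_one) (use assms in simp_all)
  finally show "monom 1 (p ^ (n - k)) - 1 dvd idem_poly i" .
qed (use assms in simp)

lemma idem_poly_orthogonal:
  assumes "i \<le> n" "j \<le> n" "i \<noteq> j"
  shows "monom 1 (p ^ n) - 1 dvd idem_poly i * idem_poly j"
proof -
  \<comment> \<open>By symmetry one order of the indices suffices. Index 0 counts as the last one,
    since \<open>idem_poly 0\<close> is \<open>avg_prod n\<close>.\<close>
  have *: "monom 1 (p ^ n) - 1 dvd idem_poly i * idem_poly j"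
    if "1 \<le> i" "i \<le> n" "j \<le> n" "i < j \<or> j = 0" for i j
  proof (cases "j = 0")
    case True
    then show ?thesis using idem_poly_mult_avg_prod[of i n] that by (simp add: idem_poly_def[of 0])
  next
    case False
    then have "idem_poly i * idem_poly j = idem_poly i * avg_prod (j - 1) - idem_poly i * avg_prod j"
      by (simp add: idem_poly_def[of j] right_diff_distrib)
    also have "monom 1 (p ^ n) - 1 dvd \<dots>"
      using that False by (intro dvd_diff idem_poly_mult_avg_prod) auto
    finally show ?thesis .
  qed
  consider "1 \<le> i" "i < j \<or> j = 0" | "1 \<le> j" "j < i \<or> i = 0" using assms(3) by linarith
  then show ?thesis
  proof cases
    case 1
    then show ?thesis using * assms by blast
  next
    case 2
    then show ?thesis using *[of j i] assms by (simp add: mult.commute)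
  qed
qed

lemma annihilator_poly_mult:
  assumes "i \<le> n"
  shows "monom 1 (p ^ n) - 1 dvd annihilator_poly i * idem_poly i"
proof (cases "i = 0")
  case True
  then show ?thesis using dvd_mult_avg_prod[of n "monom 1 1 - 1"]
    by (simp add: annihilator_poly_def idem_poly_def)
next
  case False
  then obtain k where k: "i = Suc k" using not0_implies_Suc by blast
  have "of_nat p \<noteq> (0::rat)" using prime_gt_0_nat[OF p] by simp
  then have geom: "geom_poly p (p ^ (n - i)) = smult (of_nat p) (avg_poly i)"
    by (simp add: avg_poly_def)
  \<comment> \<open>With a = \<open>avg_poly i\<close>, the relation a E_(i-1) = E_i gives a
    (E_(i-1) - E_i) = -(a - 1) E_i, and a - 1 vanishes modulo X^(p^(n-i)) - 1.\<close>
  have "annihilator_poly i * idem_poly i = smult (- of_nat p) ((avg_poly i - 1) * avg_prod i)"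
    unfolding annihilator_poly_def idem_poly_def geom using k avg_prod_Suc[of k] False
    by (simp add: algebra_simps smult_diff_right)
  then show ?thesis
    using dvd_mult_avg_prod[OF assms avg_poly_cong_one[OF order_refl assms]] by (simp add: dvd_smult)
qed

lemma irreducible_annihilator_poly: "Factorial_Ring.irreducible (annihilator_poly i)"
proof (cases "i = 0")
  case True
  have "annihilator_poly i = [:-1, 1:]"
    by (simp add: True annihilator_poly_def monom_altdef one_pCons)
  then show ?thesis by (simp add: irreducible_linear_field_poly)
next
  case False
  then show ?thesis using irreducible_geom_poly[OF p HOL.refl] by (simp add: annihilator_poly_def)
qed

lemma degree_avg_prod:
  assumes "i \<le> n"
  shows "degree (avg_prod i) = p ^ n - p ^ (n - i)" and "avg_prod i \<noteq> 0"
proof -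
  have p0: "p > 0" using p by (rule prime_gt_0_nat)
  have nz: "monom 1 m - 1 \<noteq> (0 :: rat poly)" if "m > 0" for m
    using degree_monom_minus_one[OF that, where 'a = rat] that by force
  have "smult (1 / of_nat p ^ i) (monom 1 (p ^ n) - 1) \<noteq> (0 :: rat poly)" using nz[of "p ^ n"] p0 by simp
  then show nz': "avg_prod i \<noteq> 0" using avg_prod_mult[OF assms] by auto
  have "degree ((monom 1 (p ^ (n - i)) - 1) * avg_prod i) = p ^ n"
    unfolding avg_prod_mult[OF assms] using p0 by (simp add: degree_monom_minus_one)
  then show "degree (avg_prod i) = p ^ n - p ^ (n - i)"
    using nz nz' p0 by (simp add: degree_mult_eq degree_monom_minus_one)
qed

text \<open>Supplies the premises of \<open>ev_nonzero\<close>. For i > 0 the two terms of the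
  difference have distinct degrees, so they cannot cancel.\<close>

lemma idem_poly_reduced:
  assumes "i \<le> n"
  shows "idem_poly i \<noteq> 0" and "degree (idem_poly i) < p ^ n"
proof -
  have p1: "p > 1" using p by (rule prime_gt_1_nat)
  have "degree (avg_prod k) < p ^ n" if "k \<le> n" for k
    using degree_avg_prod[OF that] p1 by simp
  then show "degree (idem_poly i) < p ^ n"
    using assms unfolding idem_poly_def by (auto intro!: degree_diff_less)
  show "idem_poly i \<noteq> 0"
  proof (cases "i = 0")
    case True
    then show ?thesis using degree_avg_prod[of n] by (simp add: idem_poly_def)
  next
    case False
    have "p ^ (n - i) < p ^ (n - (i - 1))" "p ^ (n - (i - 1)) \<le> p ^ n"
      using p1 False assms by (auto intro!: power_strict_increasing power_increasing)
    then have "p ^ n - p ^ (n - (i - 1)) \<noteq> p ^ n - p ^ (n - i)" by linarith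
    then have "degree (avg_prod (i - 1)) \<noteq> degree (avg_prod i)"
      using degree_avg_prod[of "i - 1"] degree_avg_prod[of i] assms by simp
    then show ?thesis using False by (auto simp: idem_poly_def)
  qed
qed

end

end

section \<open>Transport to the group algebra\<close>

context generated_cyclic_group
begin

lemma ev_smult: "ev (smult c P) = (\<lambda>g. c * ev P g)"
  using ev_eq[of "smult c P" "degree P"]
  by (auto simp: fun_eq_iff ev_def degree_smult_le sum_distrib_left intro!: sum.cong)

lemma ev_avg_poly: "e_avg G p (y [^] (p ^ (n - j))) = ev (avg_poly p n j)"
  using y by (auto simp: fun_eq_iff e_avg_def avg_poly_def ev_smult geom_poly_def ev_sum ev_monom group_elem_def
      nat_pow_pow mult.commute intro!: sum.cong)

lemma ev_idem_poly:
  assumes p: "Factorial_Ring.prime p"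
    and x: "\<And>j. j \<in> {1..n} \<Longrightarrow> x j = y [^] (p ^ (n - j))" and i: "i \<le> n"
  shows "e_seq G p n x i = ev (idem_poly p n i)"
proof -
  have avg: "e_avg G p (x j) = ev (avg_poly p n j)" if "j \<in> {1..n}" for j
    using that x ev_avg_poly by simp
  have prod: "(\<Otimes>\<^bsub>A\<^esub>j\<in>J. e_avg G p (x j)) = ev (\<Prod>j\<in>J. avg_poly p n j)" if "J \<subseteq> {1..n}" for J
  proof -
    have "(\<Otimes>\<^bsub>A\<^esub>j\<in>J. e_avg G p (x j)) = (\<Otimes>\<^bsub>A\<^esub>j\<in>J. ev (avg_poly p n j))"
      using that avg by (intro alg.finprod_cong') auto
    then show ?thesis using that by (simp add: ev_finprod finite_subset)
  qed
  show ?thesis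
  proof (cases "i = 0")
    case True
    then show ?thesis by (simp add: e_seq_def prod idem_poly_def avg_prod_def)
  next
    case False
    then obtain k where k: "i = Suc k" using not0_implies_Suc by blast
    have "e_compl G p (x i) = ev (1 - avg_poly p n i)"
      using avg[of i] False i by (simp add: e_compl_def ev_diff ev_1)
    moreover have "(\<Otimes>\<^bsub>A\<^esub>j\<in>{1..<i}. e_avg G p (x j)) = ev (avg_prod p n k)"
      using prod[of "{1..<i}"] i k by (simp add: avg_prod_def atLeastLessThanSuc_atLeastAtMost)
    ultimately have "e_seq G p n x i = ev (avg_prod p n k * (1 - avg_poly p n i))"
      using False by (simp add: e_seq_def ev_mult)
    then show ?thesis
      using k by (simp add: idem_poly_def avg_prod_Suc algebra_simps)
  qed
qed

text \<open>Since \<open>Q\<close> kills \<open>ev P\<close>, polynomials act on \<open>ev P\<close>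
  through the field Q[X]/(Q), where an idempotent is 0 or 1. The two cases are whether
  \<open>Q\<close> divides a lift \<open>F\<close> of \<open>f\<close> or is coprime to it.\<close>

lemma idempotent_dichotomy:
  assumes irr: "Factorial_Ring.irreducible Q" and QP: "ev (Q * P) = \<zero>\<^bsub>A\<^esub>"
    and f: "f \<in> carrier A" "f \<otimes>\<^bsub>A\<^esub> f = f"
  shows "f \<otimes>\<^bsub>A\<^esub> ev P = \<zero>\<^bsub>A\<^esub> \<or> f \<otimes>\<^bsub>A\<^esub> ev P = ev P"
proof -
  obtain F where F: "f = ev F" using f(1) by (rule ev_surj)
  consider S where "F = Q * S" | a b where "a * Q + b * F = 1"
    using irreducible_dvd_or_bezout[OF irr, of F] by blast
  then show ?thesis
  proof cases
    case 1
    then have "F * P = (Q * P) * S" by simp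
    then have "ev F \<otimes>\<^bsub>A\<^esub> ev P = ev (Q * P) \<otimes>\<^bsub>A\<^esub> ev S" by (simp only: flip: ev_mult)
    then show ?thesis using F QP by simp
  next
    case 2
    have idem: "ev (F * F - F) = \<zero>\<^bsub>A\<^esub>" using f F by (simp add: ev_diff ev_mult alg.r_right_minus_eq)
    \<comment> \<open>Multiplying (1 - F) P by the Bezout identity yields a multiple of
      \<open>Q * P\<close> and a multiple of \<open>F * F - F\<close>. The latter need not be zero
      as a polynomial, but \<open>ev\<close> kills it.\<close>
    have "P - F * P = (a * Q + b * F) * (P - F * P)" using 2 by simp
    also have "\<dots> = (Q * P) * (a * (1 - F)) - (F * F - F) * (b * P)"
      by (simp add: algebra_simps)
    also have "ev \<dots> = \<zero>\<^bsub>A\<^esub>"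
      by (simp add: ev_diff[of "(Q * P) * (a * (1 - F))"] ev_mult[of "Q * P"] ev_mult[of "F * F - F"] QP idem)
    finally have "ev P = ev (F * P)" by (simp add: ev_diff alg.r_right_minus_eq)
    then show ?thesis using F by (simp add: ev_mult)
  qed
qed

lemma primitive_central_idempotents:
  assumes p: "Factorial_Ring.prime p" and N: "N = p ^ n"
    and x: "\<And>j. j \<in> {1..n} \<Longrightarrow> x j = y [^] (p ^ (n - j))"
  shows "e_seq G p n x ` {0..n} = {e. primitive_central_idempotent A e}"
proof -
  have zero: "ev P = \<zero>\<^bsub>A\<^esub>" if "monom 1 (p ^ n) - 1 dvd P" for P
    using ev_eqI[of P 0] that N by (simp add: ev_0)
  have "(\<lambda>i. ev (idem_poly p n i)) ` {0..n} = {e. primitive_central_idempotent A e}"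
  proof (rule alg.primitive_central_idempotents_eq)
    fix i j assume "i \<in> {0..n}" "j \<in> {0..n}" "i \<noteq> j"
    then show "ev (idem_poly p n i) \<otimes>\<^bsub>A\<^esub> ev (idem_poly p n j) = \<zero>\<^bsub>A\<^esub>"
      using zero idem_poly_orthogonal[OF p, of i n j] by (simp flip: ev_mult)
  next
    fix i assume "i \<in> {0..n}"
    then show "ev (idem_poly p n i) \<noteq> \<zero>\<^bsub>A\<^esub>"
      using idem_poly_reduced[OF p] N by (intro ev_nonzero) auto
  next
    show "(\<Oplus>\<^bsub>A\<^esub>i\<in>{0..n}. ev (idem_poly p n i)) = \<one>\<^bsub>A\<^esub>"
      by (simp add: ev_finsum sum_idem_poly ev_1)
  next
    fix f i assume "f \<in> carrier A" "f \<otimes>\<^bsub>A\<^esub> f = f" "i \<in> {0..n}"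
    then show "f \<otimes>\<^bsub>A\<^esub> ev (idem_poly p n i) = \<zero>\<^bsub>A\<^esub> \<or> f \<otimes>\<^bsub>A\<^esub> ev (idem_poly p n i) = ev (idem_poly p n i)"
      using zero annihilator_poly_mult[OF p, of i n]
      by (intro idempotent_dichotomy[OF irreducible_annihilator_poly[OF p, of n i]]) auto
  qed auto
  moreover have "e_seq G p n x ` {0..n} = (\<lambda>i. ev (idem_poly p n i)) ` {0..n}"
    using ev_idem_poly[OF p x] by (intro image_cong) auto
  ultimately show ?thesis by simp
qed

end

section \<open>From the presentation to a cyclic generator\<close>

lemma (in group) word_value_replicate:
  assumes "x i \<in> carrier G"
  shows "word_value G x (replicate k (Gen i)) = x i [^] k"
proof (induction k)
  case (Suc k)
  then show ?case using assms nat_pow_Suc2[of "x i" k] by simp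
qed simp

lemma has_presentation_tower:
  fixes G (structure)
  assumes pres: "has_presentation G {1..n} x (tower_relations p n)" and n: "n \<ge> 1"
  shows "x 1 [^]\<^bsub>G\<^esub> p = \<one>\<^bsub>G\<^esub>"
    and "\<And>i. i \<in> {2..n} \<Longrightarrow> x i [^]\<^bsub>G\<^esub> p = x (i - 1)"
proof -
  interpret group G using pres by (simp add: has_presentation_def)
  have x: "x i \<in> carrier G" if "i \<in> {1..n}" for i
    using pres that by (auto simp: has_presentation_def)
  have rel: "word_value G x l = word_value G x r"
    if "(l, r) \<in> tower_relations p n" "l \<in> words_over {1..n}" "r \<in> words_over {1..n}" for l r
    using pres word_equiv.relation[OF that(1), of "{1..n}" "[]" "[]"] that(2,3)
    by (simp add: has_presentation_def)
  have words: "replicate k (Gen i) \<in> words_over {1..n}" if "i \<in> {1..n}" for k i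
    using that by (auto simp: words_over_def in_lists_conv_set)
  have "word_value G x (replicate p (Gen 1)) = word_value G x []"
    using n words by (intro rel) (auto simp: tower_relations_def words_over_def)
  then show "x 1 [^] p = \<one>" using x n by (simp add: word_value_replicate)
  fix i assume i: "i \<in> {2..n}"
  then have i_pred: "i - 1 \<in> {1..n}" by auto
  have "word_value G x (replicate p (Gen i)) = word_value G x [Gen (i - 1)]"
    using i words[of "i - 1" 1] i_pred by (intro rel words) (auto simp: tower_relations_def)
  then show "x i [^] p = x (i - 1)"
    using x[of i] x[OF i_pred] i by (simp add: word_value_replicate)
qed

lemma has_presentation_tower_power:
  fixes G (structure)
  assumes pres: "has_presentation G {1..n} x (tower_relations p n)" and n: "n \<ge> 1"
    and i: "i \<in> {1..n}"
  shows "x i = x n [^]\<^bsub>G\<^esub> (p ^ (n - i))"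
proof -
  interpret group G using pres by (simp add: has_presentation_def)
  have xn: "x n \<in> carrier G" using pres n by (auto simp: has_presentation_def)
  \<comment> \<open>The relations express x_(i-1) through x_i, so the induction runs downwards from
    \<open>n\<close>; \<open>d < n\<close> keeps the index at least 1.\<close>
  have "x (n - d) = x n [^] (p ^ d)" if "d < n" for d
    using that
  proof (induction d)
    case (Suc d)
    have "x (n - Suc d) = x (n - d) [^] p"
      using has_presentation_tower(2)[OF pres n, of "n - d"] Suc.prems by simp
    also have "\<dots> = x n [^] (p ^ Suc d)"
      using Suc xn by (simp add: nat_pow_pow mult.commute)
    finally show ?case .
  qed (use xn in simp)
  from this[of "n - i"] show ?thesis using i by simp
qed

text \<open>All generators are powers of \<open>x n\<close>, so \<open>x n\<close> generates the
  group. The cardinality then fixes its order as p^n, and its powers with exponents below p^n list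
  the group without repetition.\<close>

lemma generated_cyclic_group_tower:
  fixes G (structure)
  assumes pres: "has_presentation G {1..n} x (tower_relations p n)" and n: "n \<ge> 1"
    and p: "p > 0" and order: "Coset.order G = p ^ n"
  shows "generated_cyclic_group G (x n) (p ^ n)"
proof -
  interpret group G using pres by (simp add: has_presentation_def)
  have xn: "x n \<in> carrier G" using pres n by (auto simp: has_presentation_def)
  have fin: "finite (carrier G)"
    using order p by (intro card_ge_0_finite) (simp add: Coset.order_def)
  have "x ` {1..n} \<subseteq> generate G {x n}"
  proof
    fix g assume "g \<in> x ` {1..n}"
    then obtain i where i: "i \<in> {1..n}" "g = x i" by blast
    then have "g = x n [^] (p ^ (n - i))"
      using has_presentation_tower_power[OF pres n i(1)] by (simp only:)
    then show "g \<in> generate G {x n}"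
      unfolding generate_pow_on_finite_carrier[OF fin xn] by blast
  qed
  then have "carrier G \<subseteq> generate G {x n}"
    using generate_subgroup_incl[OF _ generate_is_subgroup] pres xn
    unfolding has_presentation_def by (metis empty_subsetI insert_subset)
  then have gen: "generate G {x n} = carrier G"
    using generate_incl[of "{x n}"] xn by blast
  then have ord: "ord (x n) = p ^ n"
    using generate_pow_card[OF xn] order by (simp add: Coset.order_def)
  \<comment> \<open>\<open>ord_inj\<close> gives injectivity on the closed range up to
    \<open>ord (x n) - 1\<close>; with truncated subtraction this is the half-open range only for
    positive order.\<close>
  have "{0..m - 1} = {..<m}" if "m > 0" for m :: nat using that by auto
  then have "{0..p ^ n - 1} = {..<p ^ n}" using p by simp
  then have inj: "inj_on (\<lambda>i. x n [^] i) {..<p ^ n}"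
    using ord_inj[OF xn] ord by simp
  moreover have "(\<lambda>i. x n [^] i) ` {..<p ^ n} = carrier G"
    using inj xn order fin by (intro card_subset_eq) (auto simp: card_image Coset.order_def)
  ultimately show ?thesis
    using xn pow_ord_eq_1[OF xn] ord
    by unfold_locales (auto simp: bij_betw_def)
qed

theorem proposition5p1:
  fixes G :: "'a monoid" and p n :: nat and x :: "nat \<Rightarrow> 'a"
  assumes "Factorial_Ring.prime p"
    and "n \<ge> 1"
    and "cyclic_group G"
    and "Coset.order G = p ^ n"
    and "has_presentation G {1..n} x (tower_relations p n)"
  shows "e_seq G p n x ` {0..n} = {e. primitive_central_idempotent (rat_group_algebra G) e}"
proof -
  interpret generated_cyclic_group G "x n" "p ^ n"
    using assms prime_gt_0_nat by (intro generated_cyclic_group_tower)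
  show ?thesis
    using assms(1) HOL.refl has_presentation_tower_power[OF assms(5,2)] by (rule primitive_central_idempotents)
qed

end
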